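(* Let $P$ be a general logic program, $S_Q$ a finite set of queries (each an atom), and $R$ the depth-first, left-most control strategy. Then $P$ is terminating w.r.t. $S_Q$ and $R$ if and only if for each query $Q_i\in S_Q$ there is no generalized SLDNF-derivation in the generalized SLDNF-tree $GT_{\leftarrow Q_i}$ of the form $N_0:G_0\Rightarrow\cdots N_{g_1}:G_{g_1}\Rightarrow\cdots N_{g_2}:G_{g_2}\Rightarrow\cdots N_{g_3}:G_{g_3}\Rightarrow\cdots$ with infinitely many nodes $N_{g_1},N_{g_2},\dots$ such that for every $j\ge1$, $G_{g_{j+1}}$ is a loop goal of $G_{g_j}$.
   Context: $P$ is terminating w.r.t. $S_Q$ and $R$ if for each query $Q_i\in S_Q$ the generalized SLDNF-tree $GT_{\leftarrow Q_i}$ for $P\cup\{\leftarrow Q_i\}$ via $R$ is finite. A general logic program is a finite set of clauses $A\leftarrow L_1,\dots,L_n$ ($A$ an atom, the $L_i$ literals). The depth-first, left-most control strategy selects the leftmost literal of a goal, tries clauses in textual order and expands nodes depth-first. Nodes are $N_i:G_i$; each literal $L$ in the goal at node $M$ carries an ancestor list $AL_{L@M}$ (a set of pairs (node name, subgoal)). SLDNF$^*$-tree $T_{N_r:G_r}$ for $P\cup\{G_r\}$, $G_r=\leftarrow A_r$, with given $AL_{A_r@N_r}$: root $N_r:G_r$; completed once a node marked LAST is generated or all leaves are marked $\Box_t,\Box_f,\Box_{fl}$. For a node $N_i:\leftarrow L_1,\dots,L_m$: if $m=0$ it is a success leaf $\Box_t$, additionally marked LAST if $AL_{A_r@N_r}\ne\emptyset$.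 If $L_1$ is positive: for each clause $B\leftarrow B_1,\dots,B_n$ with $B$ unifiable with $L_1$ (mgu $\theta$), a child $N_s:\leftarrow(B_1,\dots,B_n,L_2,\dots,L_m)\theta$ with $AL_{B_k\theta@N_s}=\{(N_i,L_1)\}\cup AL_{L_1@N_i}$ and $AL_{L_k\theta@N_s}=AL_{L_k@N_i}$; if none unifies, a single child $\Box_f$. If $L_1=\neg A$ is ground: build the subsidiary SLDNF$^*$-tree $T_{N_{i+1}:\leftarrow A}$ with $AL_{A@N_{i+1}}=AL_{L_1@N_i}$; if it has a success leaf, single child $\Box_f$; else if it has a flounder leaf, single child $\Box_{fl}$; else if all branches end in failure leaves, single child $N_s:\leftarrow L_2,\dots,L_m$ with inherited ancestor lists; otherwise $N_i$ has no child and is marked LAST. If $L_1$ is non-ground negative: single child $\Box_{fl}$. The generalized SLDNF-tree $GT_{G_0}$ for $P\cup\{G_0\}$, $G_0=\leftarrow A_0$, consists of $T_{N_0:G_0}$ with $AL_{A_0@N_0}=\emptyset$ together with all its descendant (subsidiary, recursively) SLDNF$^*$-trees, a node with ground negative selected literal $\neg A$ being connected by a dotted edge to the root $\leftarrow A$ of its subsidiary tree. A generalized SLDNF-derivation is a path in it starting at $N_0:G_0$ following tree edges and dotted edges ($\Rightarrow$ denotes either kind of edge). For a node $N_i:G_i$, $L_i^1$ is its selected (leftmost) subgoal; $L_i^1\prec_{anc}L_k^1$ means $(N_i,L_i^1)\in AL_{L_k^1@N_k}$. Symbol string $S_T$ of a term/atom $T$: the string of all predicate symbols, function symbols, constants and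 variables of $T$ read left to right, every variable replaced by the symbol $\mathcal{X}$ (list symbols $[$, $]$, $|$ count as function symbols). $S_1\subseteq_{proj}S_2$ means $S_1$ is obtained from $S_2$ by deleting zero or more elements. For atoms $A_1=p(\ldots)$, $A_2=p(\ldots)$ with the same predicate symbol, $A_1\leadsto_{loop}A_2$ means $S_{A_1}\subseteq_{proj}S_{A_2}$. For nodes $N_i:G_i$, $N_j:G_j$ in a generalized SLDNF-derivation with $L_i^1\prec_{anc}L_j^1$ and $L_i^1\leadsto_{loop}L_j^1$, $G_j$ is called a loop goal of $G_i$. *)

theory Defs
  imports Main "HOL-Library.Sublist"
begin

text \<open>
  Syntax of general logic programs.  Variables are natural numbers.  The list notation of Prolog
  has its own term constructors, since its symbols are written distfix: \<open>LNil\<close> is the term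
  \<open>[]\<close> and \<open>LCons s t\<close> is the term \<open>[s|t]\<close>.  Constants are terms \<open>Fun c []\<close>.
\<close>

datatype 'f trm =
    Var nat
  | Fun 'f "'f trm list"
  | LNil
  | LCons "'f trm" "'f trm"

datatype ('p, 'f) atom = Atom (pred: 'p) (args: "'f trm list")

datatype ('p, 'f) literal = Pos "('p, 'f) atom" | Neg "('p, 'f) atom"

datatype ('p, 'f) clause = Clause (head: "('p, 'f) atom") (body: "('p, 'f) literal list")

text \<open>The order of the list is the textual order of the clauses.\<close>

type_synonym ('p, 'f) program = "('p, 'f) clause list"

type_synonym 'f substitution = "nat \<Rightarrow> 'f trm"

primrec subst_trm :: "'f substitution \<Rightarrow> 'f trm \<Rightarrow> 'f trm" where
  "subst_trm \<theta> (Var x) = \<theta> x"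
| "subst_trm \<theta> (Fun f ts) = Fun f (map (subst_trm \<theta>) ts)"
| "subst_trm \<theta> LNil = LNil"
| "subst_trm \<theta> (LCons s t) = LCons (subst_trm \<theta> s) (subst_trm \<theta> t)"

primrec subst_atom :: "'f substitution \<Rightarrow> ('p, 'f) atom \<Rightarrow> ('p, 'f) atom" where
  "subst_atom \<theta> (Atom p ts) = Atom p (map (subst_trm \<theta>) ts)"

primrec subst_literal :: "'f substitution \<Rightarrow> ('p, 'f) literal \<Rightarrow> ('p, 'f) literal" where
  "subst_literal \<theta> (Pos A) = Pos (subst_atom \<theta> A)"
| "subst_literal \<theta> (Neg A) = Neg (subst_atom \<theta> A)"

primrec subst_clause :: "'f substitution \<Rightarrow> ('p, 'f) clause \<Rightarrow> ('p, 'f) clause" where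
  "subst_clause \<theta> (Clause B Ls) = Clause (subst_atom \<theta> B) (map (subst_literal \<theta>) Ls)"

primrec vars_trm :: "'f trm \<Rightarrow> nat set" where
  "vars_trm (Var x) = {x}"
| "vars_trm (Fun f ts) = \<Union> (set (map vars_trm ts))"
| "vars_trm LNil = {}"
| "vars_trm (LCons s t) = vars_trm s \<union> vars_trm t"

primrec vars_atom :: "('p, 'f) atom \<Rightarrow> nat set" where
  "vars_atom (Atom p ts) = \<Union> (set (map vars_trm ts))"

primrec vars_literal :: "('p, 'f) literal \<Rightarrow> nat set" where
  "vars_literal (Pos A) = vars_atom A"
| "vars_literal (Neg A) = vars_atom A"

definition ground :: "('p, 'f) atom \<Rightarrow> bool" where
  "ground A \<longleftrightarrow> vars_atom A = {}"

definition unifier :: "'f substitution \<Rightarrow> ('p, 'f) atom \<Rightarrow> ('p, 'f) atom \<Rightarrow> bool" where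
  "unifier \<theta> A B \<longleftrightarrow> subst_atom \<theta> A = subst_atom \<theta> B"

definition unifiable :: "('p, 'f) atom \<Rightarrow> ('p, 'f) atom \<Rightarrow> bool" where
  "unifiable A B \<longleftrightarrow> (\<exists>\<theta>. unifier \<theta> A B)"

definition is_mgu :: "'f substitution \<Rightarrow> ('p, 'f) atom \<Rightarrow> ('p, 'f) atom \<Rightarrow> bool" where
  "is_mgu \<theta> A B \<longleftrightarrow> unifier \<theta> A B \<and>
     (\<forall>\<tau>. unifier \<tau> A B \<longrightarrow> (\<exists>\<rho>. \<forall>x. \<tau> x = subst_trm \<rho> (\<theta> x)))"

text \<open>Most general unifiers are unique only up to renaming; an arbitrary one is fixed.\<close>

definition mgu :: "('p, 'f) atom \<Rightarrow> ('p, 'f) atom \<Rightarrow> 'f substitution" where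
  "mgu A B = (SOME \<theta>. is_mgu \<theta> A B)"

text \<open>
  Nodes are named by their addresses in the generalized tree, read from the root: \<open>Child k\<close>
  follows the tree edge to the \<open>k\<close>-th child, \<open>Sub\<close> follows the dotted edge to the root of the
  subsidiary tree.  Every literal of a goal is paired with its ancestor list.  The empty goal is
  the success leaf; \<open>Failed\<close> and \<open>Floundered\<close> label the leaves marked as failure and flounder
  leaves.
\<close>

datatype step = Child nat | Sub

type_synonym name = "step list"

type_synonym ('p, 'f) anc_list = "(name \<times> ('p, 'f) literal) set"

datatype ('p, 'f) label =
    Goal "(('p, 'f) literal \<times> ('p, 'f) anc_list) list"
  | Failed
  | Floundered

type_synonym ('p, 'f) node = "name \<times> ('p, 'f) label"

text \<open>
  A triple \<open>(N, A, al)\<close> stands for a root \<open>N : \<leftarrow> A\<close> of an SLDNF*-tree in which \<open>A\<close> has the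
  ancestor list \<open>al\<close>.
\<close>

type_synonym ('p, 'f) root = "name \<times> ('p, 'f) atom \<times> ('p, 'f) anc_list"

fun root_node :: "('p, 'f) root \<Rightarrow> ('p, 'f) node" where
  "root_node (N, A, al) = (N, Goal [(Pos A, al)])"

fun root_anc :: "('p, 'f) root \<Rightarrow> ('p, 'f) anc_list" where
  "root_anc (N, A, al) = al"

text \<open>The four cases for a subsidiary tree, in the order in which they are tested.\<close>

datatype verdict = Has_Success | Has_Flounder | All_Fail | Otherwise

text \<open>
  Clauses are standardized apart by shifting their variables beyond those of the current goal;
  this determines the resolvents up to renaming of variables.
\<close>

definition goal_vars :: "(('p, 'f) literal \<times> ('p, 'f) anc_list) list \<Rightarrow> nat set" where
  "goal_vars G = (\<Union>(L, al) \<in> set G. vars_literal L)"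

definition fresh_clause ::
    "(('p, 'f) literal \<times> ('p, 'f) anc_list) list \<Rightarrow> ('p, 'f) clause \<Rightarrow> ('p, 'f) clause" where
  "fresh_clause G C = subst_clause (\<lambda>x. Var (x + Suc (Max (insert 0 (goal_vars G))))) C"

definition resolvent ::
    "name \<Rightarrow> ('p, 'f) atom \<Rightarrow> ('p, 'f) anc_list \<Rightarrow> (('p, 'f) literal \<times> ('p, 'f) anc_list) list \<Rightarrow>
     ('p, 'f) clause \<Rightarrow> (('p, 'f) literal \<times> ('p, 'f) anc_list) list" where
  "resolvent N A al G C =
     (let \<theta> = mgu (head C) A
      in map (\<lambda>L. (subst_literal \<theta> L, insert (N, Pos A) al)) (body C) @
         map (\<lambda>(L, al'). (subst_literal \<theta> L, al')) G)"

definition resolvents ::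
    "('p, 'f) program \<Rightarrow> name \<Rightarrow> ('p, 'f) atom \<Rightarrow> ('p, 'f) anc_list \<Rightarrow>
     (('p, 'f) literal \<times> ('p, 'f) anc_list) list \<Rightarrow>
     (('p, 'f) literal \<times> ('p, 'f) anc_list) list list" where
  "resolvents P N A al G =
     map (resolvent N A al G)
       (filter (\<lambda>C. unifiable (head C) A) (map (fresh_clause ((Pos A, al) # G)) P))"

text \<open>
  The function \<open>V\<close> below gives the verdicts on subsidiary trees; the actual one is
  \<open>verdict_of P\<close>.
\<close>

fun child_labels ::
    "('p, 'f) program \<Rightarrow> (('p, 'f) root \<Rightarrow> verdict) \<Rightarrow> ('p, 'f) node \<Rightarrow> ('p, 'f) label list" where
  "child_labels P V (N, Goal []) = []"
| "child_labels P V (N, Goal ((Pos A, al) # G)) =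
     (if resolvents P N A al G = [] then [Failed] else map Goal (resolvents P N A al G))"
| "child_labels P V (N, Goal ((Neg A, al) # G)) =
     (if ground A
      then (case V (N @ [Sub], A, al) of
              Has_Success \<Rightarrow> [Failed]
            | Has_Flounder \<Rightarrow> [Floundered]
            | All_Fail \<Rightarrow> [Goal G]
            | Otherwise \<Rightarrow> [])
      else [Floundered])"
| "child_labels P V (N, Failed) = []"
| "child_labels P V (N, Floundered) = []"

definition children ::
    "('p, 'f) program \<Rightarrow> (('p, 'f) root \<Rightarrow> verdict) \<Rightarrow> ('p, 'f) node \<Rightarrow> ('p, 'f) node list" where
  "children P V x =
     map (\<lambda>k. (fst x @ [Child k], child_labels P V x ! k)) [0..<length (child_labels P V x)]"

text \<open>The node is marked LAST in the SLDNF*-tree with root \<open>r\<close>.\<close>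

fun marked_last ::
    "(('p, 'f) root \<Rightarrow> verdict) \<Rightarrow> ('p, 'f) root \<Rightarrow> ('p, 'f) node \<Rightarrow> bool" where
  "marked_last V r (N, Goal []) = (root_anc r \<noteq> {})"
| "marked_last V r (N, Goal ((Neg A, al) # G)) =
     (ground A \<and> V (N @ [Sub], A, al) = Otherwise)"
| "marked_last V r (N, l) = False"

text \<open>
  The depth-first strategy leaves the subtree below a node, and turns to the next sibling, only
  after the subtree has been expanded completely: it is then finite and contains no node marked
  LAST.  (The relation is inductive, so an infinite subtree is never exhausted.)
\<close>

inductive exhausted ::
    "('p, 'f) program \<Rightarrow> (('p, 'f) root \<Rightarrow> verdict) \<Rightarrow> ('p, 'f) root \<Rightarrow> ('p, 'f) node \<Rightarrow> bool"
  for P V r where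
  "\<not> marked_last V r x \<Longrightarrow> (\<And>y. y \<in> set (children P V x) \<Longrightarrow> exhausted P V r y) \<Longrightarrow>
     exhausted P V r x"

text \<open>
  The SLDNF*-tree with root \<open>r\<close>, as the set of the nodes generated by the depth-first strategy.
  The whole generation stops at a node marked LAST.
\<close>

inductive_set star_tree ::
    "('p, 'f) program \<Rightarrow> (('p, 'f) root \<Rightarrow> verdict) \<Rightarrow> ('p, 'f) root \<Rightarrow> ('p, 'f) node set"
  for P V r where
  root: "root_node r \<in> star_tree P V r"
| child: "x \<in> star_tree P V r \<Longrightarrow> k < length (children P V x) \<Longrightarrow>
     (\<And>j. j < k \<Longrightarrow> exhausted P V r (children P V x ! j)) \<Longrightarrow>
     children P V x ! k \<in> star_tree P V r"

fun tree_edge :: "('p, 'f) node \<Rightarrow> ('p, 'f) node \<Rightarrow> bool" where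
  "tree_edge (N, l) (N', l') \<longleftrightarrow> (\<exists>k. N' = N @ [Child k])"

fun dotted_edge :: "('p, 'f) node \<Rightarrow> ('p, 'f) node \<Rightarrow> bool" where
  "dotted_edge (N, l) (N', l') \<longleftrightarrow> N' = N @ [Sub]"

definition all_branches_fail :: "('p, 'f) node set \<Rightarrow> bool" where
  "all_branches_fail T \<longleftrightarrow>
     (\<forall>x\<in>T. (\<forall>y\<in>T. \<not> tree_edge x y) \<longrightarrow> snd x = Failed) \<and>
     (\<nexists>f :: nat \<Rightarrow> ('p, 'f) node. \<forall>i. f i \<in> T \<and> tree_edge (f i) (f (Suc i)))"

definition judge :: "('p, 'f) node set \<Rightarrow> verdict" where
  "judge T =
     (if \<exists>N. (N, Goal []) \<in> T then Has_Success
      else if \<exists>N. (N, Floundered) \<in> T then Has_Flounder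
      else if all_branches_fail T then All_Fail
      else Otherwise)"

text \<open>
  The definition of SLDNF*-trees is recursive in the verdicts on their subsidiary trees.
  \<open>has_verdict P r v\<close> is its inductive reading: a tree is judged as soon as all its own subsidiary
  trees, \<open>V\<close> being their verdicts, have been judged.  The tree itself may well be infinite.  The
  relation assigns at most one verdict to a root.

  No verdict is reached iff the tree lies above an infinite chain of nested subsidiary trees, as for
  the program \<open>p \<leftarrow> \<not> p\<close>.  The construction of the tree does not end then, and the last case of
  the definition applies.  Merely asking for some assignment of verdicts consistent with the trees
  that it induces would not do: with infinite nesting it need not be unique, and need not exist.
\<close>

inductive has_verdict :: "('p, 'f) program \<Rightarrow> ('p, 'f) root \<Rightarrow> verdict \<Rightarrow> bool"
  for P where
  "(\<And>N A al G. (N, Goal ((Neg A, al) # G)) \<in> star_tree P V r \<Longrightarrow> ground A \<Longrightarrow>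
      has_verdict P (N @ [Sub], A, al) (V (N @ [Sub], A, al))) \<Longrightarrow>
   has_verdict P r (judge (star_tree P V r))"

definition verdict_of :: "('p, 'f) program \<Rightarrow> ('p, 'f) root \<Rightarrow> verdict" where
  "verdict_of P r =
     (if \<exists>v. has_verdict P r v then THE v. has_verdict P r v else Otherwise)"

abbreviation SLDNF_star_tree :: "('p, 'f) program \<Rightarrow> ('p, 'f) root \<Rightarrow> ('p, 'f) node set" where
  "SLDNF_star_tree P r \<equiv> star_tree P (verdict_of P) r"

inductive_set gen_roots :: "('p, 'f) program \<Rightarrow> ('p, 'f) atom \<Rightarrow> ('p, 'f) root set"
  for P Q where
  top: "([], Q, {}) \<in> gen_roots P Q"
| subsidiary: "r \<in> gen_roots P Q \<Longrightarrow> (N, Goal ((Neg A, al) # G)) \<in> SLDNF_star_tree P r \<Longrightarrow>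
     ground A \<Longrightarrow> (N @ [Sub], A, al) \<in> gen_roots P Q"

definition gen_SLDNF_tree :: "('p, 'f) program \<Rightarrow> ('p, 'f) atom \<Rightarrow> ('p, 'f) node set" where
  "gen_SLDNF_tree P Q = (\<Union>r \<in> gen_roots P Q. SLDNF_star_tree P r)"

definition terminating :: "('p, 'f) program \<Rightarrow> ('p, 'f) atom set \<Rightarrow> bool" where
  "terminating P SQ \<longleftrightarrow> (\<forall>Q\<in>SQ. finite (gen_SLDNF_tree P Q))"

definition infinite_gen_derivation ::
    "('p, 'f) program \<Rightarrow> ('p, 'f) atom \<Rightarrow> (nat \<Rightarrow> ('p, 'f) node) \<Rightarrow> bool" where
  "infinite_gen_derivation P Q d \<longleftrightarrow>
     d 0 = root_node ([], Q, {}) \<and>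
     (\<forall>i. d i \<in> gen_SLDNF_tree P Q) \<and>
     (\<forall>i. tree_edge (d i) (d (Suc i)) \<or> dotted_edge (d i) (d (Suc i)))"

datatype ('p, 'f) symbol =
    Pred_Symbol 'p | Fun_Symbol 'f | Any_Var | Left_Bracket | Right_Bracket | Bar

primrec trm_string :: "'f trm \<Rightarrow> ('p, 'f) symbol list" where
  "trm_string (Var x) = [Any_Var]"
| "trm_string (Fun f ts) = Fun_Symbol f # concat (map trm_string ts)"
| "trm_string LNil = [Left_Bracket, Right_Bracket]"
| "trm_string (LCons s t) =
     [Left_Bracket] @ trm_string s @ [Bar] @ trm_string t @ [Right_Bracket]"

primrec symbol_string :: "('p, 'f) atom \<Rightarrow> ('p, 'f) symbol list" where
  "symbol_string (Atom p ts) = Pred_Symbol p # concat (map trm_string ts)"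

definition loops_into :: "('p, 'f) atom \<Rightarrow> ('p, 'f) atom \<Rightarrow> bool" (infix "\<leadsto>\<^sub>l\<^sub>o\<^sub>o\<^sub>p" 50) where
  "A \<leadsto>\<^sub>l\<^sub>o\<^sub>o\<^sub>p B \<longleftrightarrow> pred A = pred B \<and> subseq (symbol_string A) (symbol_string B)"

definition selected :: "('p, 'f) node \<Rightarrow> ('p, 'f) literal \<Rightarrow> ('p, 'f) anc_list \<Rightarrow> bool" where
  "selected x L al \<longleftrightarrow> (\<exists>G. snd x = Goal ((L, al) # G))"

text \<open>
  \<open>loop_goal x y\<close>: the goal at \<open>y\<close> is a loop goal of the goal at \<open>x\<close>.  As the relation
  \<open>\<leadsto>\<^sub>l\<^sub>o\<^sub>o\<^sub>p\<close> is between atoms, both selected subgoals are positive.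
\<close>

definition loop_goal :: "('p, 'f) node \<Rightarrow> ('p, 'f) node \<Rightarrow> bool" where
  "loop_goal x y \<longleftrightarrow>
     (\<exists>A al B al'. selected x (Pos A) al \<and> selected y (Pos B) al' \<and>
        (fst x, Pos A) \<in> al' \<and> A \<leadsto>\<^sub>l\<^sub>o\<^sub>o\<^sub>p B)"

end

theory Submission
  imports Defs "HOL-Library.Infinite_Set"
begin

text \<open>
  An infinite tree contains an infinite derivation by Koenig's lemma, the tree being finitely
  branching.  Along it some subgoal is never finished; since a subgoal is finished once all body
  literals of its resolvent are, one of these is never finished either, which gives an infinite
  chain of ancestors.  All goals are built from the finitely many symbols of the program and the
  query, because a most general unifier introduces no symbols, and Higman's lemma extracts from the
  chain a sequence of loop goals.  Conversely, the nodes of an infinite derivation are distinct.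
\<close>

section \<open>Higman's lemma\<close>

definition bad :: "(nat \<Rightarrow> 'a list) \<Rightarrow> bool" where
  "bad f \<longleftrightarrow> (\<forall>i j. i < j \<longrightarrow> \<not> subseq (f i) (f j))"

text \<open>The minimal bad sequence of Nash-Williams: its entries are fixed one after the other,
  each as short as the earlier ones permit.\<close>

lemma minimal_bad_sequence:
  assumes "bad f" "range f \<subseteq> lists S"
  obtains m where "bad m" "range m \<subseteq> lists S"
    "\<And>n g. bad g \<Longrightarrow> range g \<subseteq> lists S \<Longrightarrow> (\<And>i. i < n \<Longrightarrow> g i = m i) \<Longrightarrow> length (m n) \<le> length (g n)"
proof -
  define B where "B = {g. bad g \<and> range g \<subseteq> lists S}"
  define agree where "agree n g h \<longleftrightarrow> (\<forall>i<n. g i = h i)" for n and g h :: "nat \<Rightarrow> 'a list"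
  \<comment> \<open>The first n entries of \<open>F n\<close> are final; \<open>F (Suc n)\<close>
    keeps them and has the shortest possible entry at position n. The diagonal is the limit.\<close>
  have "\<exists>F. \<forall>n. F n \<in> B \<and> (agree n (F (Suc n)) (F n) \<and>
      (\<forall>g\<in>B. agree n g (F n) \<longrightarrow> length (F (Suc n) n) \<le> length (g n)))"
  proof (rule dependent_nat_choice)
    show "\<exists>x. x \<in> B"
      using assms by (auto simp: B_def)
    fix h n assume "h \<in> B"
    then have "h \<in> B \<and> agree n h h"
      by (simp add: agree_def)
    from ex_has_least_nat[where P = "\<lambda>g. g \<in> B \<and> agree n g h" and m = "\<lambda>g. length (g n)", OF this]
    show "\<exists>y. y \<in> B \<and> agree n y h \<and> (\<forall>g\<in>B. agree n g h \<longrightarrow> length (y n) \<le> length (g n))"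
      by blast
  qed
  then obtain F where F: "\<And>n. F n \<in> B" "\<And>n. agree n (F (Suc n)) (F n)"
    and least: "\<And>n g. g \<in> B \<Longrightarrow> agree n g (F n) \<Longrightarrow> length (F (Suc n) n) \<le> length (g n)"
    by blast
  define m where "m i = F (Suc i) i" for i
  have F_eq: "F k i = m i" if "i < k" for i k
    using that
  proof (induction k)
    case (Suc k)
    show ?case
    proof (cases "i = k")
      case False
      with Suc show ?thesis
        using F(2)[of k] by (simp add: agree_def)
    qed (simp add: m_def)
  qed simp
  show thesis
  proof
    show "bad m"
      unfolding bad_def
    proof (intro allI impI)
      fix i j :: nat assume "i < j"
      \<comment> \<open>Both entries already occur in the bad sequence
        \<open>F (Suc j)\<close>.\<close>
      then show "\<not> subseq (m i) (m j)"
        using F(1)[of "Suc j"] F_eq[of i "Suc j"] F_eq[of j "Suc j"]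
        by (simp add: B_def bad_def) (metis \<open>i < j\<close>)
    qed
    show "range m \<subseteq> lists S"
      using F(1) by (fastforce simp: m_def B_def)
  next
    fix n g assume "bad g" "range g \<subseteq> lists S" "\<And>i. i < n \<Longrightarrow> g i = m i"
    then have "g \<in> B" "agree n g (F n)"
      by (simp_all add: B_def agree_def F_eq)
    then show "length (m n) \<le> length (g n)"
      unfolding m_def by (rule least)
  qed
qed

text \<open>In a minimal bad sequence infinitely many words start with the same letter; cutting it
  off there would give a bad sequence with a shorter entry.\<close>

theorem higman:
  fixes f :: "nat \<Rightarrow> 'a list"
  assumes "finite S" "range f \<subseteq> lists S"
  shows "\<exists>i j. i < j \<and> subseq (f i) (f j)"
proof (rule ccontr)
  assume "\<not> ?thesis"
  then have "bad f"
    by (auto simp: bad_def)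
  then obtain m where m: "bad m" "range m \<subseteq> lists S"
    and least: "\<And>n g. bad g \<Longrightarrow> range g \<subseteq> lists S \<Longrightarrow> (\<And>i. i < n \<Longrightarrow> g i = m i) \<Longrightarrow>
      length (m n) \<le> length (g n)"
    by (rule minimal_bad_sequence[OF _ assms(2)]) blast
  have ne: "m i \<noteq> []" for i
    using m(1) by (metis bad_def lessI list_emb_Nil)
  have in_S: "m i \<in> lists S" for i
    using m(2) by blast
  have "hd (m i) \<in> S" for i
    using ne[of i] in_S[of i] by (cases "m i") auto
  then have "finite (range (\<lambda>i. hd (m i)))"
    using assms(1) by (meson finite_subset image_subsetI)
  then obtain k where k: "infinite {i. hd (m i) = hd (m k)}"
    using pigeonhole_infinite[of UNIV "\<lambda>i. hd (m i)"] by auto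
  obtain h :: "nat \<Rightarrow> nat" where h: "strict_mono h" "\<And>i. hd (m (h i)) = hd (m k)"
    using infinite_enumerate[OF k] by auto
  have m_h: "m (h i) = hd (m k) # tl (m (h i))" for i
    using h(2) ne by (metis list.collapse)
  \<comment> \<open>The words before \<open>h 0\<close> are kept, so that minimality of
    \<open>m\<close> applies at position \<open>h 0\<close>, where \<open>g\<close> has the tail of
    \<open>m (h 0)\<close>.\<close>
  define g where "g i = (if i < h 0 then m i else tl (m (h (i - h 0))))" for i
  have "bad g"
    unfolding bad_def
  proof (intro allI impI notI)
    fix i j :: nat assume ij: "i < j" and sub: "subseq (g i) (g j)"
    consider "j < h 0" | "i < h 0" "h 0 \<le> j" | "h 0 \<le> i"
      by linarith
    then show False
    proof cases
      case 1
      then show False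
        using ij sub m(1) by (auto simp: g_def bad_def)
    next
      case 2
      \<comment> \<open>A letter prepended on the right preserves the embedding; in the third case
        the common letter is prepended on both sides.\<close>
      then have "subseq (m i) (hd (m k) # tl (m (h (j - h 0))))"
        using sub by (simp add: g_def list_emb_Cons)
      then have "subseq (m i) (m (h (j - h 0)))"
        unfolding m_h[symmetric] .
      moreover have "i < h (j - h 0)"
        using 2 h(1) strict_mono_less_eq[of h 0 "j - h 0"] by linarith
      ultimately show False
        using m(1) by (auto simp: bad_def)
    next
      case 3
      then have "subseq (hd (m k) # tl (m (h (i - h 0)))) (hd (m k) # tl (m (h (j - h 0))))"
        using sub ij by (simp add: g_def)
      then have "subseq (m (h (i - h 0))) (m (h (j - h 0)))"
        unfolding m_h[symmetric] .
      moreover have "h (i - h 0) < h (j - h 0)"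
        using 3 ij h(1) by (auto simp: strict_mono_less)
      ultimately show False
        using m(1) by (auto simp: bad_def)
    qed
  qed
  moreover have "range g \<subseteq> lists S"
  proof (intro image_subsetI)
    fix i
    show "g i \<in> lists S"
      using in_S by (auto simp: g_def dest: list.set_sel(2)[OF ne])
  qed
  ultimately have "length (m (h 0)) \<le> length (g (h 0))"
    by (rule least) (auto simp: g_def)
  then show False
    using ne[of "h 0"] by (cases "m (h 0)") (auto simp: g_def)
qed

text \<open>An infinite set \<open>M\<close> of indices whose word embeds into no later one would
  enumerate a bad subsequence. Beyond some \<open>b\<close> a chain can thus be chosen step by
  step.\<close>

corollary higman_chain:
  fixes f :: "nat \<Rightarrow> 'a list"
  assumes "finite S" "range f \<subseteq> lists S"
  obtains h :: "nat \<Rightarrow> nat" where "strict_mono h" "\<And>j. subseq (f (h j)) (f (h (Suc j)))"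
proof -
  define M where "M = {i. \<forall>j>i. \<not> subseq (f i) (f j)}"
  have "finite M"
  proof (rule ccontr)
    assume "infinite M"
    from infinite_enumerate[OF this]
    obtain e :: "nat \<Rightarrow> nat" where e: "strict_mono e" "\<And>i. e i \<in> M"
      by auto
    have "range (f \<circ> e) \<subseteq> lists S"
      using assms(2) by (metis image_comp image_mono subset_UNIV order_trans)
    from higman[OF assms(1) this] show False
      using e by (auto simp: M_def strict_mono_less)
  qed
  then obtain b where b: "\<And>i. b \<le> i \<Longrightarrow> i \<notin> M"
    by (metis finite_nat_set_iff_bounded not_less)
  have "\<exists>h. \<forall>n. b \<le> h n \<and> (h n < h (Suc n) \<and> subseq (f (h n)) (f (h (Suc n))))"
  proof (rule dependent_nat_choice)
    fix i n assume "b \<le> i"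
    with b[of i] obtain j where "i < j" "subseq (f i) (f j)"
      by (auto simp: M_def)
    with \<open>b \<le> i\<close> show "\<exists>j. b \<le> j \<and> i < j \<and> subseq (f i) (f j)"
      by (intro exI[of _ j]) auto
  qed auto
  with that show thesis
    by (auto simp: strict_mono_Suc_iff)
qed

section \<open>Most general unifiers\<close>

lemma subst_trm_cong: "(\<And>x. x \<in> vars_trm t \<Longrightarrow> \<sigma> x = \<tau> x) \<Longrightarrow> subst_trm \<sigma> t = subst_trm \<tau> t"
  by (induction t) auto

lemma subst_trm_subst_trm: "subst_trm \<sigma> (subst_trm \<tau> t) = subst_trm (\<lambda>x. subst_trm \<sigma> (\<tau> x)) t"
  by (induction t) auto

lemma vars_subst_trm: "vars_trm (subst_trm \<sigma> t) = (\<Union>x\<in>vars_trm t. vars_trm (\<sigma> x))"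
  by (induction t) auto

lemma finite_vars_trm [simp]: "finite (vars_trm t)"
  by (induction t) auto

lemma size_subst_trm: "x \<in> vars_trm t \<Longrightarrow> size (\<tau> x) \<le> size (subst_trm \<tau> t)"
proof (induction t)
  case (Fun f ts)
  then obtain t where "t \<in> set ts" "x \<in> vars_trm t"
    by auto
  with Fun.IH have "size (\<tau> x) \<le> size (subst_trm \<tau> t)"
    by blast
  also have "\<dots> \<le> size_list size (map (subst_trm \<tau>) ts)"
    using \<open>t \<in> set ts\<close> by (intro size_list_estimation'[of "subst_trm \<tau> t"]) auto
  finally show ?case
    by simp
qed auto

text \<open>If \<open>x\<close> occurred properly inside \<open>t\<close>, the instance of
  \<open>t\<close> would be strictly larger than \<open>\<tau> x\<close>.\<close>

lemma occurs_check:
  assumes "\<tau> x = subst_trm \<tau> t" "x \<in> vars_trm t"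
  shows "t = Var x"
proof (cases t)
  case (Fun f ts)
  then obtain t' where t': "t' \<in> set ts" "x \<in> vars_trm t'"
    using assms(2) by auto
  have "size (\<tau> x) \<le> size (subst_trm \<tau> t')"
    by (rule size_subst_trm) fact
  also have "\<dots> \<le> size_list size (map (subst_trm \<tau>) ts)"
    using t'(1) by (intro size_list_estimation'[of "subst_trm \<tau> t'"]) auto
  finally show ?thesis
    using assms(1) Fun by simp
next
  case (LCons s u)
  then show ?thesis
    using assms size_subst_trm[of x s \<tau>] size_subst_trm[of x u \<tau>] by auto
qed (use assms in auto)

section \<open>Unification of systems of equations by variable elimination\<close>

definition unifies :: "'f substitution \<Rightarrow> ('f trm \<times> 'f trm) list \<Rightarrow> bool" where
  "unifies \<theta> E \<longleftrightarrow> (\<forall>(s, t)\<in>set E. subst_trm \<theta> s = subst_trm \<theta> t)"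

text \<open>Stronger than the factorization in \<open>is_mgu\<close>: the factor is the unifier
  \<tau> itself, as for idempotent most general unifiers. This form survives composition with an
  elimination step.\<close>

definition general :: "'f substitution \<Rightarrow> ('f trm \<times> 'f trm) list \<Rightarrow> bool" where
  "general \<theta> E \<longleftrightarrow> (\<forall>\<tau>. unifies \<tau> E \<longrightarrow> (\<forall>x. \<tau> x = subst_trm \<tau> (\<theta> x)))"

definition eqs_vars :: "('f trm \<times> 'f trm) list \<Rightarrow> nat set" where
  "eqs_vars E = (\<Union>(s, t)\<in>set E. vars_trm s \<union> vars_trm t)"

text \<open>The \<open>Suc\<close> counts the equation itself, so that dropping an equation between
  two terms of size 0 still decreases the measure.\<close>

definition eqs_size :: "('f trm \<times> 'f trm) list \<Rightarrow> nat" where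
  "eqs_size E = (\<Sum>(s, t)\<leftarrow>E. Suc (size s + size t))"

lemma unifies_simps [simp]:
  "unifies \<theta> []"
  "unifies \<theta> ((s, t) # E) \<longleftrightarrow> subst_trm \<theta> s = subst_trm \<theta> t \<and> unifies \<theta> E"
  "unifies \<theta> (E @ E') \<longleftrightarrow> unifies \<theta> E \<and> unifies \<theta> E'"
  by (auto simp: unifies_def)

lemma unifies_zip:
  "length ss = length ts \<Longrightarrow> unifies \<theta> (zip ss ts) \<longleftrightarrow> map (subst_trm \<theta>) ss = map (subst_trm \<theta>) ts"
  by (induction ss ts rule: list_induct2) auto

lemma eqs_vars_simps [simp]:
  "eqs_vars [] = {}"
  "eqs_vars ((s, t) # E) = vars_trm s \<union> vars_trm t \<union> eqs_vars E"
  "eqs_vars (E @ E') = eqs_vars E \<union> eqs_vars E'"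
  by (auto simp: eqs_vars_def)

lemma finite_eqs_vars [simp]: "finite (eqs_vars E)"
  by (auto simp: eqs_vars_def)

lemma eqs_vars_zip: "eqs_vars (zip ss ts) \<subseteq> \<Union> (vars_trm ` (set ss \<union> set ts))"
  by (auto simp: eqs_vars_def dest: set_zip_leftD set_zip_rightD)

lemma eqs_size_simps [simp]:
  "eqs_size [] = 0"
  "eqs_size ((s, t) # E) = Suc (size s + size t) + eqs_size E"
  "eqs_size (E @ E') = eqs_size E + eqs_size E'"
  by (auto simp: eqs_size_def)

lemma eqs_size_zip:
  "length ss = length ts \<Longrightarrow> eqs_size (zip ss ts) \<le> size_list size ss + size_list size ts"
  by (induction ss ts rule: list_induct2) auto

definition subst_eqs :: "'f substitution \<Rightarrow> ('f trm \<times> 'f trm) list \<Rightarrow> ('f trm \<times> 'f trm) list" where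
  "subst_eqs \<sigma> = map (\<lambda>(s, t). (subst_trm \<sigma> s, subst_trm \<sigma> t))"

lemma unifies_subst_eqs: "unifies \<tau> (subst_eqs \<sigma> E) \<longleftrightarrow> unifies (\<lambda>x. subst_trm \<tau> (\<sigma> x)) E"
  by (auto simp: unifies_def subst_eqs_def subst_trm_subst_trm)

lemma eqs_vars_subst_eqs: "eqs_vars (subst_eqs \<sigma> E) = (\<Union>x\<in>eqs_vars E. vars_trm (\<sigma> x))"
  by (induction E) (auto simp: subst_eqs_def vars_subst_trm)

text \<open>A unifier of \<open>Var x\<close> and \<open>t\<close> does not change when
  \<open>x\<close> is first replaced by \<open>t\<close>. It therefore unifies the reduced system,
  where generality of \<theta> applies.\<close>

lemma general_mgu_eliminate:
  assumes \<theta>: "unifies \<theta> (subst_eqs (Var(x := t)) E)" "general \<theta> (subst_eqs (Var(x := t)) E)"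
    and x: "x \<notin> vars_trm t"
  shows "\<exists>\<theta>'. unifies \<theta>' ((Var x, t) # E) \<and> general \<theta>' ((Var x, t) # E)"
proof (intro exI conjI)
  let ?\<sigma> = "Var(x := t)" and ?\<theta> = "\<lambda>y. subst_trm \<theta> ((Var(x := t)) y)"
  have t: "subst_trm ?\<theta> t = subst_trm \<theta> t"
    using x by (intro subst_trm_cong) auto
  then show "unifies ?\<theta> ((Var x, t) # E)"
    using \<theta>(1) by (simp add: unifies_subst_eqs)
  show "general ?\<theta> ((Var x, t) # E)"
    unfolding general_def
  proof (intro allI impI)
    fix \<tau> y assume \<tau>: "unifies \<tau> ((Var x, t) # E)"
    then have eq: "(\<lambda>y. subst_trm \<tau> (?\<sigma> y)) = \<tau>"
      by auto
    then have "unifies \<tau> (subst_eqs ?\<sigma> E)"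
      using \<tau> by (simp add: unifies_subst_eqs)
    then have "(\<lambda>y. subst_trm \<tau> (\<theta> y)) = \<tau>"
      using \<theta>(2) by (auto simp: general_def)
    then show "\<tau> y = subst_trm \<tau> (?\<theta> y)"
      using fun_cong[OF eq, of y] by (simp add: subst_trm_subst_trm)
  qed
qed

lemma general_mgu_cong:
  "(\<And>\<tau>. unifies \<tau> E \<longleftrightarrow> unifies \<tau> E') \<Longrightarrow>
    \<exists>\<theta>. unifies \<theta> E' \<and> general \<theta> E' \<Longrightarrow> \<exists>\<theta>. unifies \<theta> E \<and> general \<theta> E"
  by (simp add: general_def)

text \<open>Eliminating a variable decreases the number of variables; dropping or decomposing an
  equation decreases the size and adds no variables. The given unifier also solves each smaller
  system.\<close>

theorem general_mgu_exists:
  assumes "unifies \<tau> E"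
  shows "\<exists>\<theta>. unifies \<theta> E \<and> general \<theta> E"
  using assms
proof (induction E rule: wf_induct[OF wf_measures[of "[\<lambda>E. card (eqs_vars E), eqs_size]"]])
  case (1 E)
  have IH: "\<exists>\<theta>. unifies \<theta> E' \<and> general \<theta> E'"
    if "unifies \<tau> E'" "eqs_vars E' \<subseteq> eqs_vars E" "eqs_size E' < eqs_size E" for E'
  proof -
    have "card (eqs_vars E') \<le> card (eqs_vars E)"
      using that(2) by (intro card_mono) auto
    with 1 that show ?thesis
      by (auto simp: le_less)
  qed
  have elim: "\<exists>\<theta>. unifies \<theta> ((Var x, t) # E') \<and> general \<theta> ((Var x, t) # E')"
    if eq: "eqs_vars E = eqs_vars ((Var x, t) # E')" and \<tau>: "unifies \<tau> ((Var x, t) # E')"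
      and "t \<noteq> Var x" for x t E'
  proof -
    have x: "x \<notin> vars_trm t"
      using occurs_check[of \<tau> x t] \<tau> \<open>t \<noteq> Var x\<close> by auto
    let ?E = "subst_eqs (Var(x := t)) E'"
    have "(\<lambda>y. subst_trm \<tau> ((Var(x := t)) y)) = \<tau>"
      using \<tau> by auto
    then have "unifies \<tau> ?E"
      using \<tau> by (simp add: unifies_subst_eqs)
    moreover have "eqs_vars ?E \<subset> eqs_vars E"
    proof
      show "eqs_vars ?E \<subseteq> eqs_vars E"
        by (auto simp: eqs_vars_subst_eqs eq split: if_splits)
      have "x \<notin> eqs_vars ?E" "x \<in> eqs_vars E"
        using x by (auto simp: eqs_vars_subst_eqs eq split: if_splits)
      then show "eqs_vars ?E \<noteq> eqs_vars E"
        by blast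
    qed
    then have "card (eqs_vars ?E) < card (eqs_vars E)"
      by (intro psubset_card_mono) auto
    ultimately obtain \<theta> where "unifies \<theta> ?E" "general \<theta> ?E"
      using 1 by auto
    then show ?thesis
      using x by (rule general_mgu_eliminate)
  qed
  show ?case
  proof (cases E)
    case Nil
    then show ?thesis
      by (intro exI[of _ Var]) (auto simp: general_def)
  next
    case (Cons e E')
    obtain s t where E: "E = (s, t) # E'"
      using Cons by (cases e) auto
    have \<tau>: "subst_trm \<tau> s = subst_trm \<tau> t" "unifies \<tau> E'"
      using 1(2) E by auto
    \<comment> \<open>Clashes of constructors, function symbols or lengths cannot occur, as \<tau>
      unifies \<open>s\<close> and \<open>t\<close>.\<close>
    consider (triv) "s = t" | (left) x where "s = Var x" "t \<noteq> Var x"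
      | (right) x where "t = Var x" "s \<noteq> Var x"
      | (Fun) f ss ts where "s = Fun f ss" "t = Fun f ts" "length ss = length ts"
      | (LCons) a b c d where "s = LCons a b" "t = LCons c d"
      using \<tau>(1) by (cases s; cases t) (auto dest: map_eq_imp_length_eq)
    then show ?thesis
    proof cases
      case triv
      have "\<exists>\<theta>. unifies \<theta> E' \<and> general \<theta> E'"
        using \<tau>(2) by (intro IH) (auto simp: E)
      then show ?thesis
        by (rule general_mgu_cong[rotated]) (simp add: E triv)
    next
      case left
      then show ?thesis
        using elim[of x t E'] \<tau> by (simp add: E)
    next
      case right
      have "\<exists>\<theta>. unifies \<theta> ((t, s) # E') \<and> general \<theta> ((t, s) # E')"
        using elim[of x s E'] \<tau> right by (simp add: E)
      then show ?thesis
        by (rule general_mgu_cong[rotated]) (auto simp: E)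
    next
      case Fun
      let ?E = "zip ss ts @ E'"
      have "\<exists>\<theta>. unifies \<theta> ?E \<and> general \<theta> ?E"
        using \<tau> Fun eqs_size_zip[OF Fun(3)] eqs_vars_zip[of ss ts]
        by (intro IH) (auto simp: E unifies_zip)
      then show ?thesis
        by (rule general_mgu_cong[rotated]) (auto simp: E Fun unifies_zip)
    next
      case LCons
      let ?E = "(a, c) # (b, d) # E'"
      have "\<exists>\<theta>. unifies \<theta> ?E \<and> general \<theta> ?E"
        using \<tau> LCons by (intro IH) (auto simp: E)
      then show ?thesis
        by (rule general_mgu_cong[rotated]) (auto simp: E LCons)
    qed
  qed
qed

text \<open>\<open>mgu\<close> is a mere choice, so existence has to be supplied; for unifiable
  atoms it reduces to the system of paired arguments.\<close>

lemma is_mgu_mgu: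
  assumes "unifiable A B"
  shows "is_mgu (mgu A B) A B"
proof -
  obtain p ss q ts where AB: "A = Atom p ss" "B = Atom q ts"
    by (metis atom.exhaust)
  obtain \<tau> where "unifier \<tau> A B"
    using assms by (auto simp: unifiable_def)
  then have pq: "p = q" "length ss = length ts"
    by (auto simp: unifier_def AB dest: map_eq_imp_length_eq)
  have eq: "unifier \<theta> A B \<longleftrightarrow> unifies \<theta> (zip ss ts)" for \<theta>
    by (simp add: unifier_def AB pq unifies_zip)
  obtain \<theta> where "unifies \<theta> (zip ss ts)" "general \<theta> (zip ss ts)"
    using general_mgu_exists \<open>unifier \<tau> A B\<close> eq by blast
  then have "is_mgu \<theta> A B"
    unfolding is_mgu_def eq general_def by blast
  then show ?thesis
    unfolding mgu_def by (rule someI[where P = "\<lambda>\<theta>. is_mgu \<theta> A B"])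
qed

section \<open>Symbols of the goals\<close>

text \<open>Needed in the alphabet of every program: standardizing apart introduces
  \<open>Any_Var\<close>, and pruning inserts variables and keeps the list constructors.\<close>

definition common_symbols :: "('p, 'f) symbol set" where
  "common_symbols = {Any_Var, Left_Bracket, Right_Bracket, Bar}"

lemma set_trm_string_subst:
  assumes "\<And>x. set (trm_string (\<theta> x)) \<subseteq> S" "set (trm_string t) \<subseteq> S"
  shows "set (trm_string (subst_trm \<theta> t)) \<subseteq> S"
  using assms(2)
proof (induction t)
  case (Fun f ts)
  then show ?case
    by (simp add: UN_subset_iff)
qed (use assms(1) in auto)

text \<open>The only symbol of \<open>t\<close> that an instance can lose is
  \<open>Any_Var\<close>.\<close>

lemma set_trm_string_subst_rev:
  assumes "Any_Var \<in> S" "set (trm_string (subst_trm \<theta> t)) \<subseteq> S"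
  shows "set (trm_string t) \<subseteq> S"
  using assms(2)
proof (induction t)
  case (Fun f ts)
  then show ?case
    by (simp add: UN_subset_iff)
qed (use assms(1) in auto)

lemma set_symbol_string_subst:
  assumes "\<And>x. set (trm_string (\<theta> x)) \<subseteq> S" "set (symbol_string A) \<subseteq> S"
  shows "set (symbol_string (subst_atom \<theta> A)) \<subseteq> S"
  using assms set_trm_string_subst[of \<theta> S] by (cases A) (simp add: UN_subset_iff)

text \<open>Serves to turn an arbitrary unifier of atoms over \<open>S\<close> into one with values
  over \<open>S\<close>. Any fixed variable would do in place of the foreign subterms.\<close>

primrec prune :: "('p, 'f) symbol set \<Rightarrow> 'f trm \<Rightarrow> 'f trm" where
  "prune S (Var x) = Var x"
| "prune S (Fun f ts) = (if Fun_Symbol f \<in> S then Fun f (map (prune S) ts) else Var 0)"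
| "prune S LNil = LNil"
| "prune S (LCons s t) = LCons (prune S s) (prune S t)"

lemma set_trm_string_prune: "common_symbols \<subseteq> S \<Longrightarrow> set (trm_string (prune S t)) \<subseteq> S"
  by (induction t) (auto simp: common_symbols_def)

lemma prune_subst_trm:
  fixes S :: "('p, 'f) symbol set"
  shows "set (trm_string t) \<subseteq> S \<Longrightarrow> prune S (subst_trm \<theta> t) = subst_trm (\<lambda>x. prune S (\<theta> x)) t"
proof (induction t)
  case (Fun f ts)
  then have "prune S (subst_trm \<theta> t) = subst_trm (\<lambda>x. prune S (\<theta> x)) t" if "t \<in> set ts" for t
    using that by (simp add: UN_subset_iff)
  with Fun.prems show ?case
    by simp
qed auto

text \<open>Pruning a unifier yields a unifier, and the most general one has no symbols beyond it.\<close>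

lemma set_trm_string_mgu:
  fixes S :: "('p, 'f) symbol set" and A B :: "('p, 'f) atom"
  assumes "common_symbols \<subseteq> S" "set (symbol_string A) \<subseteq> S" "set (symbol_string B) \<subseteq> S"
    and "unifiable A B"
  shows "set (trm_string (mgu A B x)) \<subseteq> S"
proof -
  obtain p ss q ts where AB: "A = Atom p ss" "B = Atom q ts"
    by (metis atom.exhaust)
  obtain \<tau> where \<tau>: "unifier \<tau> A B"
    using assms(4) by (auto simp: unifiable_def)
  define \<tau>' where "\<tau>' y = prune S (\<tau> y)" for y
  have "map (subst_trm \<tau>') us = map (prune S) (map (subst_trm \<tau>) us)"
    if "\<And>u. u \<in> set us \<Longrightarrow> set (trm_string u) \<subseteq> S" for us
    using that prune_subst_trm[of _ S \<tau>] by (auto simp: \<tau>'_def[abs_def])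
  moreover have "set (trm_string u) \<subseteq> S" if "u \<in> set ss \<union> set ts" for u
    using that assms(2,3) by (auto simp: AB)
  ultimately have "unifier \<tau>' A B"
    using \<tau> by (simp add: unifier_def AB del: map_map)
  then obtain \<rho> where "\<tau>' x = subst_trm \<rho> (mgu A B x)"
    using is_mgu_mgu[OF assms(4)] by (auto simp: is_mgu_def)
  then have "set (trm_string (subst_trm \<rho> (mgu A B x))) \<subseteq> S"
    using set_trm_string_prune[OF assms(1), of "\<tau> x"] by (simp add: \<tau>'_def)
  with _ show ?thesis
    by (rule set_trm_string_subst_rev) (use assms(1) in \<open>simp add: common_symbols_def\<close>)
qed

primrec literal_symbols :: "('p, 'f) literal \<Rightarrow> ('p, 'f) symbol set" where
  "literal_symbols (Pos A) = set (symbol_string A)"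
| "literal_symbols (Neg A) = set (symbol_string A)"

lemma literal_symbols_subst:
  assumes "\<And>x. set (trm_string (\<theta> x)) \<subseteq> S" "literal_symbols L \<subseteq> S"
  shows "literal_symbols (subst_literal \<theta> L) \<subseteq> S"
  using assms set_symbol_string_subst[of \<theta> S] by (cases L) auto

definition clause_symbols :: "('p, 'f) clause \<Rightarrow> ('p, 'f) symbol set" where
  "clause_symbols C = set (symbol_string (head C)) \<union> \<Union> (literal_symbols ` set (body C))"

lemma clause_symbols_fresh:
  assumes "common_symbols \<subseteq> S" "clause_symbols C \<subseteq> S"
  shows "clause_symbols (fresh_clause G C) \<subseteq> S"
proof -
  define \<theta> :: "'b substitution" where "\<theta> = (\<lambda>x. Var (x + Suc (Max (insert 0 (goal_vars G)))))"
  have \<theta>: "set (trm_string (\<theta> x)) \<subseteq> S" for x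
    using assms(1) by (auto simp: \<theta>_def common_symbols_def)
  obtain B Ls where C: "C = Clause B Ls"
    by (cases C)
  have "set (symbol_string (subst_atom \<theta> B)) \<subseteq> S"
    using \<theta> assms(2) by (intro set_symbol_string_subst) (auto simp: C clause_symbols_def)
  moreover have "literal_symbols (subst_literal \<theta> L) \<subseteq> S" if "L \<in> set Ls" for L
    using \<theta> assms(2) that by (intro literal_symbols_subst) (auto simp: C clause_symbols_def)
  ultimately show ?thesis
    unfolding fresh_clause_def \<theta>_def[symmetric] by (simp add: C clause_symbols_def UN_subset_iff)
qed

definition goal_symbols :: "(('p, 'f) literal \<times> ('p, 'f) anc_list) list \<Rightarrow> ('p, 'f) symbol set"
  where "goal_symbols G = \<Union> (literal_symbols ` fst ` set G)"

text \<open>Every literal of a resolvent is an instance, under a most general unifier over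
  \<open>S\<close>, of a renamed body literal or of an old goal literal.\<close>

lemma goal_symbols_resolvents:
  assumes "common_symbols \<subseteq> S" "\<And>C. C \<in> set P \<Longrightarrow> clause_symbols C \<subseteq> S"
    and "goal_symbols ((Pos A, al) # G) \<subseteq> S" "H \<in> set (resolvents P N A al G)"
  shows "goal_symbols H \<subseteq> S"
proof -
  obtain C where C: "C \<in> set P" and uni: "unifiable (head (fresh_clause ((Pos A, al) # G) C)) A"
    and H: "H = resolvent N A al G (fresh_clause ((Pos A, al) # G) C)"
    using assms(4) by (auto simp: resolvents_def)
  define D where "D = fresh_clause ((Pos A, al) # G) C"
  have D: "clause_symbols D \<subseteq> S"
    unfolding D_def using assms(1,2) C by (intro clause_symbols_fresh) auto
  have \<theta>: "set (trm_string (mgu (head D) A x)) \<subseteq> S" for x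
  proof (rule set_trm_string_mgu)
    show "set (symbol_string (head D)) \<subseteq> S" "set (symbol_string A) \<subseteq> S"
      using D assms(3) by (simp_all add: clause_symbols_def goal_symbols_def)
  qed (use assms(1) uni in \<open>simp_all add: D_def\<close>)
  have subst: "literal_symbols (subst_literal (mgu (head D) A) L) \<subseteq> S"
    if "L \<in> set (body D) \<union> fst ` set G" for L
  proof (rule literal_symbols_subst[OF \<theta>])
    show "literal_symbols L \<subseteq> S"
      using that D assms(3) by (auto simp: clause_symbols_def goal_symbols_def)
  qed
  have "fst ` set H = subst_literal (mgu (head D) A) ` (set (body D) \<union> fst ` set G)"
    unfolding H D_def[symmetric]
    by (simp add: resolvent_def Let_def image_Un image_image case_prod_unfold)
  with subst show ?thesis
    by (simp add: goal_symbols_def UN_subset_iff)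
qed

section \<open>Infinite derivations\<close>

text \<open>If infinitely many nodes are reachable from a node, the same holds for one of its
  finitely many successors.\<close>

lemma koenig:
  assumes fin: "\<And>x. finite {y. R x y}" and inf: "infinite {y. R\<^sup>*\<^sup>* x y}"
  obtains d :: "nat \<Rightarrow> 'a" where "d 0 = x" "\<And>i. R (d i) (d (Suc i))"
proof -
  \<comment> \<open>The conjunct for \<open>n = 0\<close> pins the start of the chosen sequence to
    \<open>x\<close>.\<close>
  have "\<exists>d. \<forall>n. (infinite {y. R\<^sup>*\<^sup>* (d n) y} \<and> (n = 0 \<longrightarrow> d n = x)) \<and> R (d n) (d (Suc n))"
  proof (rule dependent_nat_choice)
    show "\<exists>x'. infinite {y. R\<^sup>*\<^sup>* x' y} \<and> (0 = 0 \<longrightarrow> x' = x)"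
      using inf by blast
  next
    fix x' and n :: nat assume x': "infinite {y. R\<^sup>*\<^sup>* x' y} \<and> (n = 0 \<longrightarrow> x' = x)"
    have "{y. R\<^sup>*\<^sup>* x' y} \<subseteq> insert x' (\<Union>z\<in>{z. R x' z}. {y. R\<^sup>*\<^sup>* z y})"
      by (auto elim: converse_rtranclpE)
    with x' have "infinite (\<Union>z\<in>{z. R x' z}. {y. R\<^sup>*\<^sup>* z y})"
      by (meson finite_insert finite_subset)
    with fin[of x'] show "\<exists>z. (infinite {y. R\<^sup>*\<^sup>* z y} \<and> (Suc n = 0 \<longrightarrow> z = x)) \<and> R x' z"
      by auto
  qed
  with that show thesis
    by blast
qed

section \<open>Edges of the generalized tree, read off the labels\<close>

text \<open>Covers all edges of the generalized tree, but forgets the depth-first order, the LAST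
  marks and the groundness of \<open>A\<close>. Branching stays finite, and ancestor lists can still
  be followed.\<close>

inductive successor :: "('p, 'f) program \<Rightarrow> ('p, 'f) node \<Rightarrow> ('p, 'f) node \<Rightarrow> bool" for P where
  child: "y \<in> set (children P (verdict_of P) x) \<Longrightarrow> successor P x y"
| sub: "successor P (N, Goal ((Neg A, al) # G)) (N @ [Sub], Goal [(Pos A, al)])"

lemma finite_successors: "finite {y. successor P x y}"
proof -
  \<comment> \<open>\<open>s\<close> is the only possible end of a dotted edge;
    \<open>Failed\<close> is a dummy for nodes without one.\<close>
  define s where "s = (fst x @ [Sub],
    case snd x of Goal ((Neg A, al) # G) \<Rightarrow> Goal [(Pos A, al)] | _ \<Rightarrow> Failed)"
  have "{y. successor P x y} \<subseteq> insert s (set (children P (verdict_of P) x))"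
    by (auto simp: s_def elim!: successor.cases)
  then show ?thesis
    by (rule finite_subset) simp
qed

lemma edge_successor: "successor P x y \<Longrightarrow> tree_edge x y \<or> dotted_edge x y"
  by (cases x; erule successor.cases) (auto simp: children_def)

lemma length_edge: "tree_edge x y \<or> dotted_edge x y \<Longrightarrow> length (fst y) = Suc (length (fst x))"
  by (cases x; cases y) auto

lemma child_label:
  "y \<in> set (children P V x) \<Longrightarrow> snd y \<in> set (child_labels P V x)"
  by (auto simp: children_def)

text \<open>Leaves have no successor, so the empty goal never occurs in an infinite derivation. The
  contradictions below rest on this.\<close>

lemma successor_of_goal:
  assumes "successor P x y"
  obtains L al T where "snd x = Goal ((L, al) # T)"
  using assms
proof cases
  case child
  then have "snd y \<in> set (child_labels P (verdict_of P) x)"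
    by (rule child_label)
  then show thesis
    using that by (cases "(P, verdict_of P, x)" rule: child_labels.cases) auto
qed (use that in auto)

lemma successor_goal_cases:
  assumes "successor P x y" "snd y = Goal H"
  obtains
    (Pos) A al T where "snd x = Goal ((Pos A, al) # T)" "H \<in> set (resolvents P (fst x) A al T)"
  | (Neg) A al T where "snd x = Goal ((Neg A, al) # T)" "H = T \<or> H = [(Pos A, al)]"
  using assms(1)
proof cases
  case child
  then have "Goal H \<in> set (child_labels P (verdict_of P) x)"
    using child_label assms(2) by metis
  then show thesis
    using that
    by (cases "(P, verdict_of P, x)" rule: child_labels.cases)
      (auto split: if_splits verdict.splits)
qed (use that assms(2) in auto)

section \<open>Unfinished subgoals and ancestor chains\<close>

text \<open>All body literals receive the same ancestor list and so form a block in front of the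
  unchanged lists of the old goal.\<close>

lemma resolvents_anc:
  assumes "H \<in> set (resolvents P N A al T)"
  obtains n where "map snd H = replicate n (insert (N, Pos A) al) @ map snd T"
proof -
  obtain C where "H = resolvent N A al T C"
    using assms by (auto simp: resolvents_def)
  then have "map snd H = replicate (length (body C)) (insert (N, Pos A) al) @ map snd T"
    by (simp add: resolvent_def Let_def comp_def case_prod_unfold map_replicate_const)
  with that show thesis .
qed

text \<open>
  The literals below the selected one are instantiated while it is being resolved, so they are
  recognized by their ancestor lists.
\<close>

definition finished :: "(nat \<Rightarrow> ('p, 'f) node) \<Rightarrow> ('p, 'f) anc_list \<Rightarrow> bool" where
  "finished d al \<longleftrightarrow> (\<forall>j L T. snd (d j) = Goal ((L, al) # T) \<longrightarrow>
     (\<exists>k T'. snd (d k) = Goal T' \<and> map snd T' = map snd T))"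

text \<open>The hypothesis removes one literal of the block at a time.\<close>

lemma finished_block:
  assumes "finished d al"
  shows "snd (d k) = Goal H \<Longrightarrow> map snd H = replicate n al @ as \<Longrightarrow>
    \<exists>k' T. snd (d k') = Goal T \<and> map snd T = as"
proof (induction n arbitrary: k H)
  case (Suc n)
  then obtain L T where "H = (L, al) # T" and T: "map snd T = replicate n al @ as"
    by (auto simp: map_eq_Cons_conv)
  then obtain k' T' where "snd (d k') = Goal T'" "map snd T' = map snd T"
    using assms Suc.prems(1) unfolding finished_def by blast
  with T Suc.IH show ?case
    by metis
qed auto

text \<open>Contrapositively, if the blocks of body literals of all positive subgoals with list
  \<open>al\<close> are finished, then so is \<open>al\<close>.\<close>

lemma unfinished_child:
  assumes d: "\<And>i. successor P (d i) (d (Suc i))" and "\<not> finished d al"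
  shows "\<exists>i A T. snd (d i) = Goal ((Pos A, al) # T) \<and>
    \<not> finished d (insert (fst (d i), Pos A) al)"
proof (rule ccontr)
  assume "\<not> ?thesis"
  then have fin: "finished d (insert (fst (d i), Pos A) al)"
    if "snd (d i) = Goal ((Pos A, al) # T)" for i A T
    using that by blast
  have next_goal: "\<exists>H. snd (d i) = Goal H" for i
    using successor_of_goal[OF d] by metis
  have pos: "\<exists>k T'. snd (d k) = Goal T' \<and> map snd T' = map snd T"
    if j: "snd (d j) = Goal ((Pos A, al) # T)" for j A T
  proof -
    obtain H where H: "snd (d (Suc j)) = Goal H"
      using next_goal by blast
    from d[of j] H have "H \<in> set (resolvents P (fst (d j)) A al T)"
      by (rule successor_goal_cases) (simp_all add: j)
    then obtain n where "map snd H = replicate n (insert (fst (d j), Pos A) al) @ map snd T"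
      by (rule resolvents_anc)
    with fin[OF j] H show ?thesis
      by (rule finished_block)
  qed
  have neg: "\<exists>k T'. snd (d k) = Goal T' \<and> map snd T' = map snd T"
    if j: "snd (d j) = Goal ((Neg A, al) # T)" for j A T
  proof -
    obtain H where H: "snd (d (Suc j)) = Goal H"
      using next_goal by blast
    from d[of j] H have "H = T \<or> H = [(Pos A, al)]"
      by (rule successor_goal_cases) (auto simp: j)
    then show ?thesis
    proof
      assume "H = [(Pos A, al)]"
      \<comment> \<open>Nothing follows the literal at the root of a subsidiary tree, so finishing
        it would produce the empty goal inside an infinite derivation.\<close>
      with pos[of "Suc j" A "[]"] H obtain k where "snd (d k) = Goal []"
        by auto
      with successor_of_goal[OF d[of k]] show ?thesis
        by auto
    qed (use H in blast)
  qed
  have "finished d al"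
    unfolding finished_def
  proof (intro allI impI)
    fix j L T assume "snd (d j) = Goal ((L, al) # T)"
    with pos neg show "\<exists>k T'. snd (d k) = Goal T' \<and> map snd T' = map snd T"
      by (cases L) blast+
  qed
  with assms(2) show False
    by blast
qed

text \<open>The query has the empty list and nothing after it, so finishing it would give the empty
  goal. Iterating \<open>unfinished_child\<close> from there yields growing lists
  \<open>al n\<close>.\<close>

lemma infinite_ancestor_chain:
  assumes d0: "d 0 = root_node ([], Q, {})" and d: "\<And>i. successor P (d i) (d (Suc i))"
  obtains t :: "nat \<Rightarrow> nat" and A al where "strict_mono t"
    "\<And>n. selected (d (t n)) (Pos (A n)) (al n)"
    "\<And>m n. m < n \<Longrightarrow> (fst (d (t m)), Pos (A m)) \<in> al n"
proof -
  define step where "step al al' \<longleftrightarrow> (\<exists>i A T. snd (d i) = Goal ((Pos A, al) # T) \<and>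
    al' = insert (fst (d i), Pos A) al)" for al al'
  have "\<not> finished d {}"
  proof
    assume "finished d {}"
    moreover have "snd (d 0) = Goal [(Pos Q, {})]"
      by (simp add: d0)
    ultimately obtain k where "snd (d k) = Goal []"
      unfolding finished_def by fastforce
    with successor_of_goal[OF d[of k]] show False
      by auto
  qed
  have "\<exists>al. \<forall>n. \<not> finished d (al n) \<and> step (al n) (al (Suc n))"
  proof (rule dependent_nat_choice)
    show "\<exists>al. \<not> finished d al"
      using \<open>\<not> finished d {}\<close> by blast
    fix al n assume "\<not> finished d al"
    from unfinished_child[of P d, OF d this]
    show "\<exists>al'. \<not> finished d al' \<and> step al al'"
      unfolding step_def by blast
  qed
  then obtain al where "\<And>n. step (al n) (al (Suc n))"
    by blast
  then obtain t A T where goal: "\<And>n. snd (d (t n)) = Goal ((Pos (A n), al n) # T n)"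
    and al_Suc: "\<And>n. al (Suc n) = insert (fst (d (t n)), Pos (A n)) (al n)"
    unfolding step_def by metis
  have length_d: "length (fst (d i)) = i" for i
    by (induction i) (simp_all add: d0 length_edge[OF edge_successor[OF d]])
  \<comment> \<open>The indices \<open>t n\<close> come from \<open>unfinished_child\<close> in no
    evident order. They increase because the length of a name is its depth and recorded ancestors
    lie strictly higher up.\<close>
  have names: "length N < i"
    if "snd (d i) = Goal H" "al' \<in> set (map snd H)" "(N, M) \<in> al'" for i H al' N M
    using that
  proof (induction i arbitrary: H al')
    case (Suc i)
    from d[of i] Suc.prems(1) show ?case
    proof (cases rule: successor_goal_cases)
      case (Pos A al T)
      from resolvents_anc[OF Pos(2)] obtain n
        where "map snd H = replicate n (insert (fst (d i), Pos A) al) @ map snd T" .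
      then have "al' = insert (fst (d i), Pos A) al \<or> al' \<in> set (map snd T)"
        using Suc.prems(2) by (auto split: if_splits)
      then have "N = fst (d i) \<or> (N, M) \<in> al \<or> al' \<in> set (map snd T)"
        using Suc.prems(3) by auto
      then show ?thesis
        using Suc.IH[OF Pos(1), of al] Suc.IH[OF Pos(1), of al'] Suc.prems(3) length_d[of i]
        by (elim disjE) (simp_all add: less_SucI)
    next
      case (Neg A al T)
      then have "al' \<in> set (map snd ((Neg A, al) # T))"
        using Suc.prems(2) by auto
      from Suc.IH[OF Neg(1) this Suc.prems(3)] show ?thesis
        by simp
    qed
  qed (auto simp: d0)
  show thesis
  proof
    show "strict_mono t"
      unfolding strict_mono_Suc_iff
    proof
      fix n
      show "t n < t (Suc n)"
        using names[OF goal[of "Suc n"], of "al (Suc n)" "fst (d (t n))" "Pos (A n)"]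
        by (simp add: al_Suc length_d)
    qed
    show "selected (d (t n)) (Pos (A n)) (al n)" for n
      using goal by (auto simp: selected_def)
    show "(fst (d (t m)), Pos (A m)) \<in> al n" if "m < n" for m n
      using that
    proof (induction n)
      case (Suc n)
      then show ?case
        by (cases "m = n") (auto simp: al_Suc)
    qed simp
  qed
qed

section \<open>Loop goals by Higman's lemma\<close>

definition derivation_symbols :: "('p, 'f) program \<Rightarrow> ('p, 'f) atom \<Rightarrow> ('p, 'f) symbol set" where
  "derivation_symbols P Q =
     common_symbols \<union> \<Union> (clause_symbols ` set P) \<union> set (symbol_string Q)"

lemma finite_derivation_symbols: "finite (derivation_symbols P Q)"
proof -
  have "finite (literal_symbols L)" for L :: "('p, 'f) literal"
    by (cases L) auto
  then show ?thesis
    by (auto simp: derivation_symbols_def common_symbols_def clause_symbols_def)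
qed

lemma goal_symbols_derivation:
  assumes d0: "d 0 = root_node ([], Q, {})" and d: "\<And>i. successor P (d i) (d (Suc i))"
  shows "snd (d i) = Goal H \<Longrightarrow> goal_symbols H \<subseteq> derivation_symbols P Q"
proof (induction i arbitrary: H)
  case 0
  then show ?case
    by (auto simp: d0 goal_symbols_def derivation_symbols_def)
next
  case (Suc i)
  from d[of i] Suc.prems show ?case
  proof (cases rule: successor_goal_cases)
    case (Pos A al T)
    from _ _ Suc.IH[OF Pos(1)] Pos(2) show ?thesis
      by (rule goal_symbols_resolvents) (auto simp: derivation_symbols_def)
  next
    case (Neg A al T)
    with Suc.IH[OF Neg(1)] show ?thesis
      by (auto simp: goal_symbols_def)
  qed
qed

text \<open>A predicate symbol occurs in a symbol string only at the front.\<close>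

lemma pred_eq_if_subseq:
  assumes "subseq (symbol_string A) (symbol_string B)"
  shows "pred A = pred B"
proof (rule ccontr)
  assume neq: "pred A \<noteq> pred B"
  obtain p ss q ts where AB: "A = Atom p ss" "B = Atom q ts"
    by (metis atom.exhaust)
  have "Pred_Symbol p \<notin> set (trm_string t)" for t :: "'b trm"
    by (induction t) auto
  moreover have "Pred_Symbol p \<in> set (concat (map trm_string ts))"
    using assms neq list_emb_set[of "(=)" "symbol_string A" "symbol_string B" "Pred_Symbol p"]
    by (auto simp: AB)
  ultimately show False
    by auto
qed

lemma loop_goals_in_derivation:
  assumes d0: "d 0 = root_node ([], Q, {})" and d: "\<And>i. successor P (d i) (d (Suc i))"
  obtains g :: "nat \<Rightarrow> nat" where "strict_mono g" "\<And>j. loop_goal (d (g j)) (d (g (Suc j)))"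
proof -
  obtain t :: "nat \<Rightarrow> nat" and A al where t: "strict_mono t"
    and sel: "\<And>n. selected (d (t n)) (Pos (A n)) (al n)"
    and anc: "\<And>m n. m < n \<Longrightarrow> (fst (d (t m)), Pos (A m)) \<in> al n"
    by (rule infinite_ancestor_chain[of d Q P, OF d0 d]) blast
  have "set (symbol_string (A n)) \<subseteq> derivation_symbols P Q" for n
    using sel[of n] goal_symbols_derivation[of d Q P, OF d0 d, of "t n"]
    by (auto simp: selected_def goal_symbols_def)
  then have "range (\<lambda>n. symbol_string (A n)) \<subseteq> lists (derivation_symbols P Q)"
    by blast
  with finite_derivation_symbols
  obtain h :: "nat \<Rightarrow> nat" where h: "strict_mono h"
    "\<And>j. subseq (symbol_string (A (h j))) (symbol_string (A (h (Suc j))))"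
    by (rule higman_chain) blast
  show thesis
  \<comment> \<open>Any two members of the chain are related by ancestry, so passing to the
    subsequence \<open>h\<close> keeps this relation between neighbours.\<close>
  proof (rule that[of "t \<circ> h"])
    show "strict_mono (t \<circ> h)"
      using t h(1) by (simp add: strict_mono_def)
    fix j
    have "A (h j) \<leadsto>\<^sub>l\<^sub>o\<^sub>o\<^sub>p A (h (Suc j))"
      using h(2)[of j] pred_eq_if_subseq by (auto simp: loops_into_def)
    moreover have "h j < h (Suc j)"
      using h(1) by (simp add: strict_mono_less)
    ultimately show "loop_goal (d ((t \<circ> h) j)) (d ((t \<circ> h) (Suc j)))"
      unfolding loop_goal_def comp_def using sel anc by blast
  qed
qed

section \<open>Infinite trees and infinite derivations\<close>

text \<open>One induction runs inside a single tree, the other over the nesting of subsidiary trees.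
  \<open>R\<close> demands membership of its targets because \<open>successor\<close> alone could
  lead out of the generalized tree.\<close>

lemma gen_SLDNF_tree_reachable:
  fixes P :: "('p, 'f) program" and Q :: "('p, 'f) atom"
  defines "R \<equiv> \<lambda>x y. y \<in> gen_SLDNF_tree P Q \<and> successor P x y"
  assumes "x \<in> gen_SLDNF_tree P Q"
  shows "R\<^sup>*\<^sup>* (root_node ([], Q, {})) x"
proof -
  have star: "R\<^sup>*\<^sup>* (root_node ([], Q, {})) x"
    if "x \<in> SLDNF_star_tree P r" "r \<in> gen_roots P Q" "R\<^sup>*\<^sup>* (root_node ([], Q, {})) (root_node r)"
    for x r
    using that
  proof (induction rule: star_tree.induct)
    case (child x k)
    have "children P (verdict_of P) x ! k \<in> SLDNF_star_tree P r"
      using child by (intro star_tree.child) auto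
    with child have "R x (children P (verdict_of P) x ! k)"
      by (auto simp: R_def gen_SLDNF_tree_def intro!: successor.child)
    with child show ?case
      by (auto intro: rtranclp.rtrancl_into_rtrancl)
  qed simp
  have "R\<^sup>*\<^sup>* (root_node ([], Q, {})) (root_node r)" if "r \<in> gen_roots P Q" for r
    using that
  proof (induction rule: gen_roots.induct)
    case (subsidiary r N A al G)
    then have "(N @ [Sub], A, al) \<in> gen_roots P Q"
      by (intro gen_roots.subsidiary)
    then have "root_node (N @ [Sub], A, al) \<in> gen_SLDNF_tree P Q"
      unfolding gen_SLDNF_tree_def by (blast intro: star_tree.root)
    then have "R (N, Goal ((Neg A, al) # G)) (root_node (N @ [Sub], A, al))"
      by (auto simp: R_def intro: successor.sub)
    with star[OF subsidiary(2) subsidiary(1) subsidiary.IH] show ?case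
      by (rule rtranclp.rtrancl_into_rtrancl)
  qed simp
  with star assms(2) show ?thesis
    unfolding gen_SLDNF_tree_def by blast
qed

lemma infinite_tree_loops:
  assumes "infinite (gen_SLDNF_tree P Q)"
  obtains d and g :: "nat \<Rightarrow> nat" where "infinite_gen_derivation P Q d" "strict_mono g"
    "\<And>j. loop_goal (d (g j)) (d (g (Suc j)))"
proof -
  define R where "R x y \<longleftrightarrow> y \<in> gen_SLDNF_tree P Q \<and> successor P x y" for x y
  have "gen_SLDNF_tree P Q \<subseteq> {x. R\<^sup>*\<^sup>* (root_node ([], Q, {})) x}"
    using gen_SLDNF_tree_reachable[of _ P Q] unfolding R_def[abs_def] by blast
  with assms have "infinite {x. R\<^sup>*\<^sup>* (root_node ([], Q, {})) x}"
    using finite_subset by blast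
  moreover have "finite {y. R x y}" for x
    by (rule finite_subset[OF _ finite_successors[of P x]]) (auto simp: R_def)
  ultimately obtain d where d0: "d 0 = root_node ([], Q, {})" and d: "\<And>i. R (d i) (d (Suc i))"
    using koenig[of R "root_node ([], Q, {})"] by blast
  have succ: "successor P (d i) (d (Suc i))" for i
    using d by (simp add: R_def)
  have "d 0 \<in> gen_SLDNF_tree P Q"
    unfolding d0 gen_SLDNF_tree_def by (blast intro: gen_roots.top star_tree.root)
  then have "d i \<in> gen_SLDNF_tree P Q" for i
    using d by (cases i) (auto simp: R_def)
  then have "infinite_gen_derivation P Q d"
    using d0 edge_successor[OF succ] by (auto simp: infinite_gen_derivation_def)
  then show thesis
    by (rule loop_goals_in_derivation[of d Q P, OF d0 succ, OF that])
qed

text \<open>Each edge appends one step to the name, so the length of the name recovers the index and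
  no node repeats.\<close>

lemma infinite_tree_if_derivation:
  assumes "infinite_gen_derivation P Q d"
  shows "infinite (gen_SLDNF_tree P Q)"
proof -
  have edge: "length (fst (d (Suc i))) = Suc (length (fst (d i)))" for i
    using assms by (intro length_edge) (simp add: infinite_gen_derivation_def)
  have "length (fst (d i)) = i" for i
    by (induction i) (use assms in \<open>simp_all add: infinite_gen_derivation_def edge\<close>)
  then have "inj d"
    by (metis injI)
  moreover have "range d \<subseteq> gen_SLDNF_tree P Q"
    using assms by (auto simp: infinite_gen_derivation_def)
  ultimately show ?thesis
    using finite_subset range_inj_infinite by blast
qed

theorem theorem4p3:
  fixes P :: "('p, 'f) program" and SQ :: "('p, 'f) atom set"
  assumes "finite SQ"
  shows "terminating P SQ \<longleftrightarrow>
    (\<forall>Q\<in>SQ. \<not> (\<exists>(d :: nat \<Rightarrow> ('p, 'f) node) (g :: nat \<Rightarrow> nat).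
        infinite_gen_derivation P Q d \<and> strict_mono g \<and>
        (\<forall>j. loop_goal (d (g j)) (d (g (Suc j))))))"
  unfolding terminating_def
proof (intro ball_cong refl iffI)
  fix Q assume "finite (gen_SLDNF_tree P Q)"
  then show "\<not> (\<exists>d g. infinite_gen_derivation P Q d \<and> strict_mono (g :: nat \<Rightarrow> nat) \<and>
      (\<forall>j. loop_goal (d (g j)) (d (g (Suc j)))))"
    using infinite_tree_if_derivation by blast
next
  fix Q assume no: "\<not> (\<exists>d g. infinite_gen_derivation P Q d \<and> strict_mono (g :: nat \<Rightarrow> nat) \<and>
      (\<forall>j. loop_goal (d (g j)) (d (g (Suc j)))))"
  show "finite (gen_SLDNF_tree P Q)"
  proof (rule ccontr)
    assume "infinite (gen_SLDNF_tree P Q)"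
    then show False
      by (rule infinite_tree_loops) (use no in blast)
  qed
qed

end
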